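(* Consider an $(N,K,L,R)$-gradient code whose encoding matrix $\mathbf{E}=\mathbf{M}$ is the incidence matrix of an affine resolvable $(v,b,k,r,\lambda)$-BIBD, so that $N=b$, $K=v$, $L=k$, $R=r$. Fix a resolution of the blocks into parallel classes and let $\mathcal{T}_1,\dots,\mathcal{T}_R$ be the corresponding partition of $[N]$ (so $j\in\mathcal{T}_i$ iff the $j$-th block lies in the $i$-th parallel class). Consider a set (of non-stragglers) $\mathcal{F}\subseteq[N]$ of size $N-S$ with straggler profile $[S_1\ S_2\ \cdots\ S_R]$, where $S_i=K/L-|\mathcal{F}\cap\mathcal{T}_i|$. Order the columns of $\mathbf{E}_{\mathcal{F}}$ so that those in $\mathcal{F}\cap\mathcal{T}_1$ come first, then those in $\mathcal{F}\cap\mathcal{T}_2$, and so on. Put $\mu:=L^2/K$, $\hat S_0:=0$ and $\hat S_i:=\sum_{p=1}^{i}(K/L-S_p)$ for $i\in[R]$. 1. If there exists an $i\in[R]$ such that $S_i=0$, then (for such an $i$) an optimal decoding vector is $$\mathbf{v}_{\mathrm{opt}}(j)=\begin{cases}1 & \text{for } \hat S_{i-1}+1\le j\le\hat S_i,\\ 0&\text{otherwise},\end{cases}$$ and the corresponding approximation error is $\mathrm{err}_{\mathcal{F}}(\mathbf{E})=0$. 2. Suppose $S_i>0$ for all $i\in[R]$, and set $$c_i=\frac{L/\left(L-\mu(K/L-S_i)\right)}{1+\sum_{p=1}^{R}\frac{\mu(K/L-S_p)}{L-\mu(K/L-S_p)}},\qquad i\in[R].$$ Then an optimal decoding vector is $\mathbf{v}_{\mathrm{opt}}(j)=c_i$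 for $\hat S_{i-1}+1\le j\le\hat S_i$, $i\in[R]$, and the corresponding approximation error is $$\mathrm{err}_{\mathcal{F}}(\mathbf{E})=K+2\sum_{i=1}^{R}L(K/L-S_i)c_i(c_i-2)+\sum_{i=1}^{R}\sum_{\substack{j=1\\ j\ne i}}^{R}\mu(K/L-S_i)(K/L-S_j)c_ic_j.$$
   Context: A design is a pair $(X,\mathcal{A})$ where $X=\{x_1,\dots,x_v\}$ is a finite set of points and $\mathcal{A}=\{A_1,\dots,A_b\}$ is a collection of nonempty subsets of $X$ called blocks. Its incidence matrix is the $v\times b$ binary matrix $\mathbf{M}$ with $\mathbf{M}_{i,j}=1$ if $x_i\in A_j$ and $0$ otherwise. A $(v,b,k,r,\lambda)$-balanced incomplete block design (BIBD) is a design with $v$ points and $b$ blocks, each block of size $k$, such that every point is contained in exactly $r$ blocks and any pair of distinct points is contained in exactly $\lambda$ blocks. A parallel class is a set of pairwise disjoint blocks whose union is $X$ (it has exactly $v/k$ blocks). A resolution is a partition of $\mathcal{A}$ into $r$ parallel classes, and a BIBD is resolvable if it has at least one resolution. A resolvable BIBD is affine resolvable if $b=v+r-1$ (equivalently $r=k+\lambda$). An $(N,K,L,R)$-gradient code, with $N$ workers and $K$ data parts, is given by an encoding matrix $\mathbf{E}\in\mathbb{R}^{K\times N}$; $L$ is the maximum number of nonzero entries in a column, $R$ the minimum number of nonzero entries in a row. For $\mathcal{F}\subseteq[N]=\{1,\dots,N\}$, $\mathbf{E}_{\mathcal{F}}$ is the submatrix of the columns indexed by $\mathcal{F}$; $\mathbf{1}_m$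 is the $m\times1$ all-ones vector. For $|\mathcal{F}|=N-S$, the approximation error is $\mathrm{err}_{\mathcal{F}}(\mathbf{E})=\min_{\mathbf{v}\in\mathbb{R}^{N-S}}\|\mathbf{E}_{\mathcal{F}}\mathbf{v}-\mathbf{1}_K\|_2^2$, and a minimizer is called an optimal decoding vector. The number $S_i$ in the straggler profile is the number of elements of $\mathcal{T}_i$ not in $\mathcal{F}$ (the stragglers in $\mathcal{T}_i$), and $\sum_{i=1}^R S_i=S$.
   Formalization: In part 2 the error formula is proved without the factor 2 before the first sum; with that factor it is false (for the 2-subsets of a 4-set with one straggler per class it gives −7/2, while the true error is 1). *)

theory Defs
  imports Complex_Main "HOL-Library.Disjoint_Sets" "Jordan_Normal_Form.Matrix"
begin

text \<open>A design with a fixed enumeration of its points and blocks: \<open>xs\<close> lists the points,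
  \<open>Bs\<close> lists the blocks. The list of blocks may contain repetitions. List positions, rows and
  columns are counted from 0, so the index set \<open>[N]\<close> of columns is \<open>{..<N}\<close>.\<close>

definition design :: "'a list \<Rightarrow> 'a set list \<Rightarrow> bool" where
  "design xs Bs \<longleftrightarrow> distinct xs \<and> (\<forall>B\<in>set Bs. B \<noteq> {} \<and> B \<subseteq> set xs)"

definition incidence_matrix :: "'a list \<Rightarrow> 'a set list \<Rightarrow> real mat" where
  "incidence_matrix xs Bs =
     mat (length xs) (length Bs) (\<lambda>(i, j). if xs ! i \<in> Bs ! j then 1 else 0)"

definition bibd :: "nat \<Rightarrow> nat \<Rightarrow> nat \<Rightarrow> nat \<Rightarrow> nat \<Rightarrow> 'a list \<Rightarrow> 'a set list \<Rightarrow> bool" where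
  "bibd v b k r l xs Bs \<longleftrightarrow>
     design xs Bs \<and> length xs = v \<and> length Bs = b \<and>
     (\<forall>B\<in>set Bs. card B = k) \<and>
     (\<forall>x\<in>set xs. card {j. j < b \<and> x \<in> Bs ! j} = r) \<and>
     (\<forall>x\<in>set xs. \<forall>y\<in>set xs. x \<noteq> y \<longrightarrow> card {j. j < b \<and> x \<in> Bs ! j \<and> y \<in> Bs ! j} = l)"

text \<open>Since blocks may be repeated, parallel classes and resolutions are sets of block indices.\<close>

definition parallel_class :: "'a list \<Rightarrow> 'a set list \<Rightarrow> nat set \<Rightarrow> bool" where
  "parallel_class xs Bs P \<longleftrightarrow>
     P \<subseteq> {..<length Bs} \<and> disjoint_family_on (\<lambda>j. Bs ! j) P \<and> (\<Union>j\<in>P. Bs ! j) = set xs"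

text \<open>The parallel classes of a resolution are \<open>T 1, \<dots>, T r\<close>; other values of \<open>T\<close> are
  irrelevant.\<close>

definition resolution :: "'a list \<Rightarrow> 'a set list \<Rightarrow> nat \<Rightarrow> (nat \<Rightarrow> nat set) \<Rightarrow> bool" where
  "resolution xs Bs r T \<longleftrightarrow>
     (\<forall>i\<in>{1..r}. parallel_class xs Bs (T i)) \<and>
     disjoint_family_on T {1..r} \<and> (\<Union>i\<in>{1..r}. T i) = {..<length Bs}"

definition affine_resolvable_bibd ::
  "nat \<Rightarrow> nat \<Rightarrow> nat \<Rightarrow> nat \<Rightarrow> nat \<Rightarrow> 'a list \<Rightarrow> 'a set list \<Rightarrow> bool" where
  "affine_resolvable_bibd v b k r l xs Bs \<longleftrightarrow>
     bibd v b k r l xs Bs \<and> (\<exists>T. resolution xs Bs r T) \<and> int b = int v + int r - 1"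

text \<open>Positivity of \<open>N\<close> and \<open>K\<close> makes the maximum and the minimum below well defined.\<close>

definition gradient_code :: "nat \<Rightarrow> nat \<Rightarrow> nat \<Rightarrow> nat \<Rightarrow> real mat \<Rightarrow> bool" where
  "gradient_code N K L R E \<longleftrightarrow>
     0 < N \<and> 0 < K \<and> E \<in> carrier_mat K N \<and>
     L = Max ((\<lambda>j. card {i. i < K \<and> E $$ (i, j) \<noteq> 0}) ` {..<N}) \<and>
     R = Min ((\<lambda>i. card {j. j < N \<and> E $$ (i, j) \<noteq> 0}) ` {..<K})"

text \<open>The submatrix of the columns in a set \<open>F\<close>, in the order given by an enumeration \<open>cs\<close>
  of the set.\<close>

definition column_submatrix :: "real mat \<Rightarrow> nat list \<Rightarrow> real mat" where
  "column_submatrix E cs = mat (dim_row E) (length cs) (\<lambda>(i, j). E $$ (i, cs ! j))"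

definition ordered_by_classes :: "nat \<Rightarrow> (nat \<Rightarrow> nat set) \<Rightarrow> nat set \<Rightarrow> nat list \<Rightarrow> bool" where
  "ordered_by_classes R T F cs \<longleftrightarrow>
     distinct cs \<and> set cs = F \<and>
     sorted_wrt (\<lambda>x y. \<forall>p\<in>{1..R}. \<forall>q\<in>{1..R}. x \<in> T p \<longrightarrow> y \<in> T q \<longrightarrow> p \<le> q) cs"

definition residual_sq :: "real mat \<Rightarrow> real vec \<Rightarrow> real" where
  "residual_sq A w =
     (let d = A *\<^sub>v w - vec (dim_row A) (\<lambda>_. 1) in d \<bullet> d)"

definition optimal_decoding_vector :: "real mat \<Rightarrow> nat list \<Rightarrow> real vec \<Rightarrow> bool" where
  "optimal_decoding_vector E cs w \<longleftrightarrow>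
     is_arg_min (residual_sq (column_submatrix E cs)) (\<lambda>u. u \<in> carrier_vec (length cs)) w"

text \<open>The minimum does not depend on the order in which \<open>cs\<close> enumerates the columns.\<close>

definition approx_error :: "real mat \<Rightarrow> nat list \<Rightarrow> real" where
  "approx_error E cs =
     (LEAST e. e \<in> residual_sq (column_submatrix E cs) ` carrier_vec (length cs))"

end

theory Submission
  imports Defs
begin

text \<open>
  In an affine resolvable design, fix a block \<open>A\<close> and let \<open>B\<close> range over the blocks outside the
  parallel class of \<open>A\<close>. Counting flags determines the sum and the sum of squares of
  \<open>|A \<inter> B|\<close>, and \<open>b = v + r - 1\<close> says exactly that the variance vanishes; hence
  \<open>|A \<inter> B| = k\<^sup>2 / v\<close> always. So the Gram matrix of the columns is \<open>k\<close> on the diagonal, \<open>0\<close>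
  inside a class and \<open>\<mu>\<close> between classes. For a vector constant on classes the normal equations
  become \<open>(k - \<mu> n\<^sub>i) c\<^sub>i + \<Sum>\<^sub>p \<mu> n\<^sub>p c\<^sub>p = k\<close>, a rank-one perturbation of a diagonal system, and
  \<open>c\<close> is its solution. If a class contains no stragglers, its columns add up to \<open>1\<close>.
\<close>

text \<open>Serves to turn cardinalities into column positions: a set of positions closed under
  going left is fixed by its size.\<close>

lemma downward_closed_eq_lessThan:
  fixes D :: "nat set"
  assumes "finite D" and down: "\<And>i j. j \<in> D \<Longrightarrow> i \<le> j \<Longrightarrow> i \<in> D"
  shows "D = {..<card D}"
proof (cases "D = {}")
  case False
  then have "Max D \<in> D" and le: "\<And>j. j \<in> D \<Longrightarrow> j \<le> Max D"
    using \<open>finite D\<close> by simp_all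
  then have "D = {..Max D}"
    using down by blast
  then show ?thesis
    by (metis card_atMost lessThan_Suc_atMost)
qed simp

lemma sum_nth_eq:
  fixes f :: "'b \<Rightarrow> 'c::comm_monoid_add"
  assumes "distinct cs"
  shows "(\<Sum>j<length cs. f (cs ! j)) = (\<Sum>m\<in>set cs. f m)"
  by (rule sum.reindex_bij_betw[OF bij_betw_nth[OF assms refl refl]])

subsection \<open>Resolved block designs\<close>

locale resolved_bibd =
  fixes v b k r l :: nat and xs :: "'a list" and Bs :: "'a set list" and T :: "nat \<Rightarrow> nat set"
  assumes bibd: "bibd v b k r l xs Bs" and resolution: "resolution xs Bs r T"
begin

lemma distinct_points: "distinct xs"
  and length_points: "length xs = v"
  and length_blocks: "length Bs = b"
  using bibd by (auto simp: bibd_def design_def)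

lemma card_points: "card (set xs) = v"
  using distinct_card[OF distinct_points] length_points by simp

lemma block_subset: "j < b \<Longrightarrow> Bs ! j \<subseteq> set xs"
  and block_nonempty: "j < b \<Longrightarrow> Bs ! j \<noteq> {}"
  and card_block: "j < b \<Longrightarrow> card (Bs ! j) = k"
  using bibd by (auto simp: bibd_def design_def)

lemma finite_block: "j < b \<Longrightarrow> finite (Bs ! j)"
  using block_subset finite_subset by blast

lemma block_size_pos: "j < b \<Longrightarrow> 0 < k"
  using card_block block_nonempty finite_block by fastforce

lemma card_blocks_through: "x \<in> set xs \<Longrightarrow> card {j. j < b \<and> x \<in> Bs ! j} = r"
  using bibd by (auto simp: bibd_def)

lemma card_blocks_through_two:
  "x \<in> set xs \<Longrightarrow> y \<in> set xs \<Longrightarrow> x \<noteq> y \<Longrightarrow> card {j. j < b \<and> x \<in> Bs ! j \<and> y \<in> Bs ! j} = l"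
  using bibd by (auto simp: bibd_def)

lemma class_subset: "i \<in> {1..r} \<Longrightarrow> T i \<subseteq> {..<b}"
  using resolution length_blocks by (auto simp: resolution_def parallel_class_def)

lemma finite_class: "i \<in> {1..r} \<Longrightarrow> finite (T i)"
  using class_subset finite_subset by blast

lemma blocks_disjoint:
  "i \<in> {1..r} \<Longrightarrow> m \<in> T i \<Longrightarrow> n \<in> T i \<Longrightarrow> m \<noteq> n \<Longrightarrow> Bs ! m \<inter> Bs ! n = {}"
  using resolution by (auto simp: resolution_def parallel_class_def disjoint_family_on_def)

lemma class_covers: "i \<in> {1..r} \<Longrightarrow> (\<Union>j\<in>T i. Bs ! j) = set xs"
  using resolution by (auto simp: resolution_def parallel_class_def)

lemma classes_disjoint: "i \<in> {1..r} \<Longrightarrow> p \<in> {1..r} \<Longrightarrow> i \<noteq> p \<Longrightarrow> T i \<inter> T p = {}"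
  using resolution by (auto simp: resolution_def disjoint_family_on_def)

lemma classes_cover: "(\<Union>i\<in>{1..r}. T i) = {..<b}"
  using resolution length_blocks by (auto simp: resolution_def)

lemma class_unique: "i \<in> {1..r} \<Longrightarrow> p \<in> {1..r} \<Longrightarrow> m \<in> T i \<Longrightarrow> m \<in> T p \<Longrightarrow> i = p"
  using classes_disjoint by blast

text \<open>Inverts the partition into classes, so that a vector constant on classes is a function
  \<open>c (class_index m)\<close> of the block index. The choice is unique for
  \<open>m < b\<close>.\<close>

definition class_index :: "nat \<Rightarrow> nat" where
  "class_index m = (SOME i. i \<in> {1..r} \<and> m \<in> T i)"

lemma class_index: "m < b \<Longrightarrow> class_index m \<in> {1..r} \<and> m \<in> T (class_index m)"
  unfolding class_index_def by (rule someI_ex) (use classes_cover in blast)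

lemma class_index_eq: "i \<in> {1..r} \<Longrightarrow> m \<in> T i \<Longrightarrow> class_index m = i"
  using class_index class_subset class_unique by blast

lemma sum_by_classes:
  fixes f :: "nat \<Rightarrow> 'c::comm_monoid_add"
  assumes "F \<subseteq> {..<b}"
  shows "(\<Sum>m\<in>F. f m) = (\<Sum>p=1..r. \<Sum>m\<in>F \<inter> T p. f m)"
proof -
  have "F = (\<Union>p\<in>{1..r}. F \<inter> T p)"
    using assms classes_cover by blast
  then have "(\<Sum>m\<in>F. f m) = (\<Sum>m\<in>(\<Union>p\<in>{1..r}. F \<inter> T p). f m)"
    by simp
  also have "\<dots> = (\<Sum>p=1..r. \<Sum>m\<in>F \<inter> T p. f m)"
  proof (rule sum.UNION_disjoint)
    show "\<forall>i\<in>{1..r}. \<forall>p\<in>{1..r}. i \<noteq> p \<longrightarrow> F \<inter> T i \<inter> (F \<inter> T p) = {}"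
      using classes_disjoint by blast
  qed (use finite_class in auto)
  finally show ?thesis .
qed

lemma card_class_mult: "i \<in> {1..r} \<Longrightarrow> card (T i) * k = v"
proof -
  assume i: "i \<in> {1..r}"
  have "v = card (\<Union>j\<in>T i. Bs ! j)"
    using class_covers[OF i] card_points by simp
  also have "\<dots> = (\<Sum>j\<in>T i. card (Bs ! j))"
    by (rule card_UN_disjoint)
      (use i finite_class finite_block class_subset blocks_disjoint in auto)
  also have "\<dots> = (\<Sum>j\<in>T i. k)"
    using card_block class_subset[OF i] by (intro sum.cong) auto
  finally show ?thesis by simp
qed

text \<open>Flags are counted class by class: each of the \<open>r\<close> classes contains every
  point once, hence contributes \<open>v\<close>.\<close>

lemma blocks_mult: "b * k = v * r"
proof -
  have "b * k = (\<Sum>j<b. k)" by simp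
  also have "\<dots> = (\<Sum>p=1..r. \<Sum>j\<in>{..<b} \<inter> T p. k)"
    by (rule sum_by_classes) simp
  also have "\<dots> = (\<Sum>p=1..r. v)"
  proof (rule sum.cong)
    fix p assume "p \<in> {1..r}"
    then show "(\<Sum>j\<in>{..<b} \<inter> T p. k) = v"
      using class_subset[of p] card_class_mult[of p] by (simp add: Int_absorb1)
  qed simp
  finally show ?thesis by (simp add: mult.commute)
qed

lemma sum_class_mem:
  assumes "i \<in> {1..r}" "x \<in> set xs"
  shows "(\<Sum>j\<in>T i. of_bool (x \<in> Bs ! j)) = (1::real)"
proof -
  obtain m where m: "m \<in> T i" "x \<in> Bs ! m"
    using class_covers assms by blast
  then have "T i \<inter> {j. x \<in> Bs ! j} = {m}"
    using blocks_disjoint[OF assms(1)] by blast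
  then show ?thesis
    using finite_class[OF assms(1)] by simp
qed

section \<open>Double counting and block intersection sizes\<close>

lemma sum_blocks_mem: "x \<in> set xs \<Longrightarrow> (\<Sum>j<b. of_bool (x \<in> Bs ! j)) = real r"
  using card_blocks_through[of x] by (simp add: Collect_conj_eq lessThan_def)

lemma sum_blocks_mem_two:
  assumes "x \<in> set xs" "y \<in> set xs"
  shows "(\<Sum>j<b. of_bool (x \<in> Bs ! j) * of_bool (y \<in> Bs ! j)) =
    (if x = y then real r else real l)"
proof -
  have "(\<Sum>j<b. of_bool (x \<in> Bs ! j) * of_bool (y \<in> Bs ! j)) =
      (\<Sum>j<b. of_bool (x \<in> Bs ! j \<and> y \<in> Bs ! j) :: real)"
    by (simp add: of_bool_conj)
  also have "\<dots> = real (card {j. j < b \<and> x \<in> Bs ! j \<and> y \<in> Bs ! j})"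
    by (simp add: Collect_conj_eq lessThan_def)
  finally show ?thesis
    using card_blocks_through card_blocks_through_two assms by auto
qed

text \<open>With sizes written as sums of indicators, each counting argument below is an exchange of
  finite sums.\<close>

lemma card_inter_block: "finite A \<Longrightarrow> real (card (A \<inter> B)) = (\<Sum>x\<in>A. of_bool (x \<in> B))"
  by simp

text \<open>Counts pairs of a point \<open>y\<close> and a block containing both \<open>x\<close>
  and \<open>y\<close>. The choice \<open>y = x\<close> is allowed, which accounts for the summand
  \<open>r\<close>.\<close>

lemma pair_count:
  assumes "x \<in> set xs"
  shows "real r * real k = real r + (real v - 1) * real l"
proof -
  have "(\<Sum>y\<in>set xs. \<Sum>j<b. of_bool (x \<in> Bs ! j) * of_bool (y \<in> Bs ! j)) =
      (\<Sum>y\<in>set xs. if x = y then real r else real l)"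
    using sum_blocks_mem_two assms by (intro sum.cong) auto
  also have "\<dots> = (\<Sum>y\<in>set xs. real l + (if x = y then real r - real l else 0))"
    by (intro sum.cong) auto
  also have "\<dots> = real r + (real v - 1) * real l"
    using assms card_points by (simp add: sum.distrib algebra_simps)
  finally have 1: "(\<Sum>y\<in>set xs. \<Sum>j<b. of_bool (x \<in> Bs ! j) * of_bool (y \<in> Bs ! j)) =
      real r + (real v - 1) * real l" .
  have "(\<Sum>y\<in>set xs. \<Sum>j<b. of_bool (x \<in> Bs ! j) * of_bool (y \<in> Bs ! j)) =
      (\<Sum>j<b. of_bool (x \<in> Bs ! j) * (\<Sum>y\<in>set xs. of_bool (y \<in> Bs ! j)) :: real)"
    by (subst sum.swap) (simp only: sum_distrib_left)
  also have "\<dots> = (\<Sum>j<b. of_bool (x \<in> Bs ! j) * real k)"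
  proof (intro sum.cong refl)
    fix j assume "j \<in> {..<b}"
    then have "set xs \<inter> Bs ! j = Bs ! j" "card (Bs ! j) = k"
      using block_subset card_block by auto
    then show "of_bool (x \<in> Bs ! j) * (\<Sum>y\<in>set xs. of_bool (y \<in> Bs ! j)) =
        of_bool (x \<in> Bs ! j) * real k"
      by simp
  qed
  also have "\<dots> = real r * real k"
    using sum_blocks_mem[OF assms] by (simp only: sum_distrib_right[symmetric])
  finally show ?thesis using 1 by simp
qed

lemma sum_inter:
  assumes "m < b"
  shows "(\<Sum>j<b. real (card (Bs ! m \<inter> Bs ! j))) = real k * real r"
proof -
  have "(\<Sum>j<b. real (card (Bs ! m \<inter> Bs ! j))) =
      (\<Sum>x\<in>Bs ! m. \<Sum>j<b. of_bool (x \<in> Bs ! j))"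
    by (subst sum.swap) (simp only: card_inter_block[OF finite_block[OF assms]])
  also have "\<dots> = (\<Sum>x\<in>Bs ! m. real r)"
    using sum_blocks_mem block_subset[OF assms] by (intro sum.cong) auto
  finally show ?thesis using card_block[OF assms] by simp
qed

text \<open>The square counts ordered pairs of points in the intersection: the \<open>k\<close>
  diagonal pairs lie in \<open>r\<close> blocks each, the \<open>k * (k - 1)\<close> others in
  \<open>l\<close>.\<close>

lemma sum_inter_square:
  assumes "m < b"
  shows "(\<Sum>j<b. (real (card (Bs ! m \<inter> Bs ! j)))\<^sup>2) =
    real k * real r + real k * (real k - 1) * real l"
proof -
  let ?A = "Bs ! m"
  have "(\<Sum>j<b. (real (card (?A \<inter> Bs ! j)))\<^sup>2) =
      (\<Sum>j<b. \<Sum>x\<in>?A. \<Sum>y\<in>?A. of_bool (x \<in> Bs ! j) * of_bool (y \<in> Bs ! j))"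
    by (simp only: card_inter_block[OF finite_block[OF assms]] power2_eq_square sum_product)
  also have "\<dots> = (\<Sum>x\<in>?A. \<Sum>j<b. \<Sum>y\<in>?A. of_bool (x \<in> Bs ! j) * of_bool (y \<in> Bs ! j))"
    by (rule sum.swap)
  also have "\<dots> = (\<Sum>x\<in>?A. \<Sum>y\<in>?A. \<Sum>j<b. of_bool (x \<in> Bs ! j) * of_bool (y \<in> Bs ! j))"
    by (intro sum.cong refl sum.swap)
  also have "\<dots> = (\<Sum>x\<in>?A. \<Sum>y\<in>?A. real l + (if x = y then real r - real l else 0))"
    using block_subset[OF assms] by (intro sum.cong refl) (subst sum_blocks_mem_two, auto)
  also have "\<dots> = (\<Sum>x\<in>?A. real k * real l + (real r - real l))"
    using finite_block[OF assms] card_block[OF assms]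
    by (intro sum.cong refl) (simp add: sum.distrib)
  finally show ?thesis
    using card_block[OF assms] by (simp add: algebra_simps)
qed

lemma class_inter:
  assumes "i \<in> {1..r}" "m \<in> T i" "j \<in> T i"
  shows "real (card (Bs ! m \<inter> Bs ! j)) = (if j = m then real k else 0)"
  using blocks_disjoint[OF assms(1,2,3)] card_block class_subset[OF assms(1)] assms by auto

text \<open>First and second moments of \<open>n j\<close> are known over all blocks; removing the
  class of \<open>m\<close>, which contributes only \<open>j = m\<close>, gives them over
  \<open>?J\<close>. The sum of squared deviations from \<open>t\<close> is then
  \<open>0\<close>.\<close>

lemma affine_inter:
  assumes affine: "int b = int v + int r - 1"
    and i: "i \<in> {1..r}" "m \<in> T i" and j: "j < b" "j \<notin> T i"
  shows "real (card (Bs ! m \<inter> Bs ! j)) = (real k)\<^sup>2 / real v"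
proof -
  have m: "m < b" using class_subset i by auto
  have k: "0 < real k" using block_size_pos[OF m] by simp
  define q where "q = real (card (T i))"
  \<comment> \<open>For \<open>r > 1\<close> this is the mean of \<open>n j\<close> over
    \<open>?J\<close>, namely \<open>k * (r - 1)\<close> divided by \<open>q * (r - 1)\<close>; for
    \<open>r = 1\<close> the set \<open>?J\<close> is empty.\<close>
  define t where "t = real k / q"
  define n where "n j = real (card (Bs ! m \<inter> Bs ! j))" for j
  let ?J = "{..<b} - T i"
  have v: "real v = q * real k"
    using card_class_mult[OF i(1)] by (simp add: q_def flip: of_nat_mult)
  have q: "0 < q"
    using i finite_class[OF i(1)] by (auto simp: q_def card_gt_0_iff)
  have t: "t = (real k)\<^sup>2 / real v"
    using k q by (simp add: t_def v power2_eq_square)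
  have bq: "real b = q * real r"
  proof -
    have "real b * real k = (q * real r) * real k"
      using blocks_mult v by (metis mult.assoc mult.commute of_nat_mult)
    then show ?thesis using k by simp
  qed
  \<comment> \<open>The affine condition in terms of \<open>q\<close>, \<open>k\<close> and
    \<open>r\<close> alone, since \<open>b = q * r\<close> and \<open>v = q * k\<close>.\<close>
  have aff: "q * real r = q * real k + real r - 1"
  proof -
    have "real_of_int (int b) = real_of_int (int v + int r - 1)" using affine by simp
    then show ?thesis using bq v by simp
  qed
  obtain x where x: "x \<in> set xs"
    using block_nonempty[OF m] block_subset[OF m] by blast
  have pair: "real r * real k = real r + (q * real k - 1) * real l"
    using pair_count[OF x] v by simp
  have split: "(\<Sum>j\<in>?J. f j) = (\<Sum>j<b. f j) - (\<Sum>j\<in>T i. f j)" for f :: "nat \<Rightarrow> real"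
    using class_subset[OF i(1)] by (simp add: sum_diff)
  have "(\<Sum>j\<in>T i. n j) = (\<Sum>j\<in>T i. if j = m then real k else 0)"
    unfolding n_def using class_inter[OF i] by (intro sum.cong) auto
  then have S1: "(\<Sum>j\<in>?J. n j) = real k * (real r - 1)"
    using split[of n] sum_inter[OF m] finite_class[OF i(1)] i
    by (simp add: n_def algebra_simps)
  have "(\<Sum>j\<in>T i. (n j)\<^sup>2) = (\<Sum>j\<in>T i. if j = m then (real k)\<^sup>2 else 0)"
    unfolding n_def using class_inter[OF i] by (intro sum.cong) auto
  then have S2: "(\<Sum>j\<in>?J. (n j)\<^sup>2) =
      real k * real r + real k * (real k - 1) * real l - (real k)\<^sup>2"
    using split[of "\<lambda>j. (n j)\<^sup>2"] sum_inter_square[OF m] finite_class[OF i(1)] i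
    by (simp add: n_def)
  have "(\<Sum>j\<in>?J. 1) = q * (real r - 1)"
    using split[of "\<lambda>_. 1"] bq by (simp add: q_def algebra_simps)
  then have S0: "real (card ?J) = q * (real r - 1)" by simp
  \<comment> \<open>This is \<open>r = k + l\<close> multiplied by \<open>k - 1\<close>. For
    \<open>v = 1\<close> there are no pairs of points and \<open>l\<close> is arbitrary, but then
    \<open>k = 1\<close> and the factor vanishes. For \<open>k > 1\<close> also
    \<open>v > 1\<close>, so \<open>v - 1\<close> can be cancelled.\<close>
  have l: "(real k - 1) * real l = (real k - 1) * (real r - real k)"
  proof (cases "k = 1")
    case False
    have "1 \<le> q" using q by (simp add: q_def Suc_le_eq)
    then have "1 * real k \<le> q * real k"
      by (rule mult_right_mono) simp
    moreover have "1 < real k"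
      using False k by simp
    ultimately have "q * real k \<noteq> 1" by linarith
    moreover have "(q * real k - 1) * real l = (q * real k - 1) * (real r - real k)"
    proof -
      have "(q * real k - 1) * (real r - real k) =
          real k * (q * real r) - real k * (q * real k) - real r + real k"
        by (simp add: algebra_simps)
      also have "\<dots> = real r * real k - real r"
        unfolding aff by (simp add: algebra_simps)
      finally show ?thesis using pair by linarith
    qed
    ultimately show ?thesis by simp
  qed simp
  have tq: "t * q = real k" using q by (simp add: t_def)
  have "(\<Sum>j\<in>?J. (n j - t)\<^sup>2) =
      (\<Sum>j\<in>?J. (n j)\<^sup>2 - 2 * t * n j + t\<^sup>2)"
    by (simp add: power2_diff algebra_simps)
  also have "\<dots> = (\<Sum>j\<in>?J. (n j)\<^sup>2) - 2 * t * (\<Sum>j\<in>?J. n j) + t\<^sup>2 * real (card ?J)"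
    by (simp add: sum.distrib sum_subtractf sum_distrib_left)
  also have "\<dots> = real k * real r + real k * (real k - 1) * real l - (real k)\<^sup>2
      - 2 * t * (real k * (real r - 1)) + t\<^sup>2 * (q * (real r - 1))"
    by (simp only: S0 S1 S2)
  \<comment> \<open>Regrouped so that \<open>(k - 1) * l\<close> and \<open>t * q\<close> appear as
    subterms for the next rewriting.\<close>
  also have "\<dots> = real k * real r + real k * ((real k - 1) * real l) - (real k)\<^sup>2
      - 2 * t * (real k * (real r - 1)) + t * ((t * q) * (real r - 1))"
    by (simp add: algebra_simps power2_eq_square)
  also have "\<dots> = real k * (real k * (real r - real k) - t * (real r - 1))"
    unfolding l tq by (simp add: algebra_simps power2_eq_square)
  finally have var: "(\<Sum>j\<in>?J. (n j - t)\<^sup>2) =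
      real k * (real k * (real r - real k) - t * (real r - 1))" .
  \<comment> \<open>Multiplying by \<open>q\<close> produces the product \<open>q * r\<close>, which
    \<open>aff\<close> can eliminate.\<close>
  have "q * (\<Sum>j\<in>?J. (n j - t)\<^sup>2) =
      real k * (real k * (q * real r) - real k * (q * real k) - (t * q) * (real r - 1))"
    unfolding var by (simp add: algebra_simps)
  also have "\<dots> = 0"
    unfolding tq aff by (simp add: algebra_simps)
  finally have "q * (\<Sum>j\<in>?J. (n j - t)\<^sup>2) = 0" .
  then have "(\<Sum>j\<in>?J. (n j - t)\<^sup>2) = 0" using q by simp
  then have "\<forall>j\<in>?J. (n j - t)\<^sup>2 = 0"
    by (subst (asm) sum_nonneg_eq_0_iff) auto
  then show ?thesis using j t by (auto simp: n_def)
qed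

subsection \<open>Encoding matrix and enumeration of the columns\<close>

lemma incidence_entry:
  "x < v \<Longrightarrow> j < b \<Longrightarrow> incidence_matrix xs Bs $$ (x, j) = of_bool (xs ! x \<in> Bs ! j)"
  by (simp add: incidence_matrix_def length_points length_blocks)

text \<open>All columns have \<open>k\<close> nonzero entries and all rows have \<open>r\<close>, so
  the maximum and the minimum are taken over singletons; these are nonempty because \<open>b\<close>
  and \<open>v\<close> are positive.\<close>

lemma gradient_code_parameters:
  assumes "gradient_code N K L R (incidence_matrix xs Bs)"
  shows "N = b" "K = v" "L = k" "R = r"
proof -
  let ?E = "incidence_matrix xs Bs"
  have "?E \<in> carrier_mat v b"
    by (simp add: incidence_matrix_def length_points length_blocks)
  then show N: "N = b" and K: "K = v"
    using assms unfolding gradient_code_def by auto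
  have pos: "0 < b" "0 < v"
    using assms N K by (auto simp: gradient_code_def)
  have "card {i. i < v \<and> ?E $$ (i, j) \<noteq> 0} = k" if j: "j < b" for j
  proof -
    have "{i. i < v \<and> ?E $$ (i, j) \<noteq> 0} = {i. i < v \<and> xs ! i \<in> Bs ! j}"
      using j by (auto simp: incidence_entry)
    moreover have "card {i. i < v \<and> xs ! i \<in> Bs ! j} = card (Bs ! j)"
    proof (rule bij_betw_same_card)
      show "bij_betw ((!) xs) {i. i < v \<and> xs ! i \<in> Bs ! j} (Bs ! j)"
        unfolding bij_betw_def using block_subset[OF j] distinct_points length_points
        by (auto simp: inj_on_def nth_eq_iff_index_eq image_iff in_set_conv_nth subset_iff)
    qed
    ultimately show ?thesis
      using card_block[OF j] by simp
  qed
  then have "(\<lambda>j. card {i. i < v \<and> ?E $$ (i, j) \<noteq> 0}) ` {..<b} = {k}"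
    using pos by (auto simp: image_iff)
  then show "L = k" using assms N K by (simp add: gradient_code_def)
  have "card {j. j < b \<and> ?E $$ (i, j) \<noteq> 0} = r" if i: "i < v" for i
  proof -
    have "{j. j < b \<and> ?E $$ (i, j) \<noteq> 0} = {j. j < b \<and> xs ! i \<in> Bs ! j}"
      using i by (auto simp: incidence_entry)
    then show ?thesis
      using card_blocks_through[of "xs ! i"] i length_points by simp
  qed
  then have "(\<lambda>i. card {j. j < b \<and> ?E $$ (i, j) \<noteq> 0}) ` {..<v} = {r}"
    using pos by (auto simp: image_iff)
  then show "R = r" using assms N K by (simp add: gradient_code_def)
qed

text \<open>The order of \<open>cs\<close> makes the class index nondecreasing along positions.
  Positions with index at most \<open>i\<close> therefore form an initial segment, whose length is
  the number of columns in the first \<open>i\<close> classes.\<close>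

lemma column_position_le:
  assumes F: "F \<subseteq> {..<b}" and ord: "ordered_by_classes r T F cs" and i: "i \<le> r"
    and j: "j < length cs"
  shows "class_index (cs ! j) \<le> i \<longleftrightarrow> j < (\<Sum>p=1..i. card (F \<inter> T p))"
proof -
  have cs: "distinct cs" "set cs = F"
    and sorted: "sorted_wrt (\<lambda>x y. \<forall>p\<in>{1..r}. \<forall>q\<in>{1..r}. x \<in> T p \<longrightarrow> y \<in> T q \<longrightarrow> p \<le> q) cs"
    using ord by (auto simp: ordered_by_classes_def)
  have lt: "cs ! j < b" if "j < length cs" for j
    using that cs F nth_mem by blast
  let ?D = "{j. j < length cs \<and> class_index (cs ! j) \<le> i}"
  have mono: "class_index (cs ! x) \<le> class_index (cs ! y)" if "x \<le> y" "y < length cs" for x y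
  proof (cases "x = y")
    case False
    then have "x < y" using that by simp
    moreover have "cs ! x < b" "cs ! y < b" using lt that by auto
    ultimately show ?thesis
      using sorted_wrt_nth_less[OF sorted] that class_index by blast
  qed simp
  have D: "?D = {..<card ?D}"
  proof (rule downward_closed_eq_lessThan)
    fix x y assume "y \<in> ?D" "x \<le> y"
    then show "x \<in> ?D" using mono[of x y] by auto
  qed simp
  have "bij_betw ((!) cs) ?D {m \<in> F. class_index m \<le> i}"
    unfolding bij_betw_def using cs
    by (auto simp: inj_on_def nth_eq_iff_index_eq image_iff in_set_conv_nth)
  then have "card ?D = card {m \<in> F. class_index m \<le> i}"
    by (rule bij_betw_same_card)
  also have "{m \<in> F. class_index m \<le> i} = (\<Union>p\<in>{1..i}. F \<inter> T p)"
  proof (intro equalityI subsetI)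
    fix m assume "m \<in> {m \<in> F. class_index m \<le> i}"
    then show "m \<in> (\<Union>p\<in>{1..i}. F \<inter> T p)"
      using class_index[of m] F by (auto intro!: bexI[of _ "class_index m"])
  next
    fix m assume "m \<in> (\<Union>p\<in>{1..i}. F \<inter> T p)"
    then obtain p where "p \<in> {1..i}" "m \<in> F" "m \<in> T p" by blast
    then show "m \<in> {m \<in> F. class_index m \<le> i}"
      using class_index_eq[of p m] i by auto
  qed
  also have "card \<dots> = (\<Sum>p=1..i. card (F \<inter> T p))"
  proof (rule card_UN_disjoint)
    show "\<forall>p\<in>{1..i}. \<forall>q\<in>{1..i}. p \<noteq> q \<longrightarrow> F \<inter> T p \<inter> (F \<inter> T q) = {}"
      using i classes_disjoint by fastforce
  qed (use i finite_class in auto)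
  finally have "?D = {..<(\<Sum>p=1..i. card (F \<inter> T p))}"
    using D by simp
  then show ?thesis using j by blast
qed

text \<open>Combines the bounds for \<open>i\<close> and \<open>i - 1\<close>. Positions in
  \<open>cs\<close> start at 0 while \<open>Sh\<close> counts from 1, hence
  \<open>Suc j\<close>.\<close>

lemma column_position:
  assumes F: "F \<subseteq> {..<b}" and ord: "ordered_by_classes r T F cs" and i: "i \<in> {1..r}"
    and j: "j < length cs"
    and Sh: "\<And>i. i \<le> r \<Longrightarrow> Sh i = real (\<Sum>p=1..i. card (F \<inter> T p))"
  shows "Sh (i - 1) + 1 \<le> real (Suc j) \<and> real (Suc j) \<le> Sh i \<longleftrightarrow> class_index (cs ! j) = i"
proof -
  have le: "real (Suc j) \<le> Sh p \<longleftrightarrow> class_index (cs ! j) \<le> p" if "p \<le> r" for p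
    using column_position_le[OF F ord that j] Sh[OF that] by (simp only: of_nat_le_iff Suc_le_eq)
  \<comment> \<open>The values of \<open>Sh\<close> are integers here, so the real inequality with
    \<open>+ 1\<close> is a negated one.\<close>
  have "Sh (i - 1) + 1 \<le> real (Suc j) \<longleftrightarrow> \<not> real (Suc j) \<le> Sh (i - 1)"
    using Sh[of "i - 1"] i by (auto simp flip: of_nat_sum)
  moreover have "i - 1 \<le> r" "i \<le> r"
    using i by auto
  moreover have "class_index (cs ! j) = i \<longleftrightarrow>
      \<not> class_index (cs ! j) \<le> i - 1 \<and> class_index (cs ! j) \<le> i"
    using i by auto
  ultimately show ?thesis
    using le by simp
qed

section \<open>Least squares and the normal equations\<close>

lemma residual_sq_columns:
  assumes F: "F \<subseteq> {..<b}" and cs: "distinct cs" "set cs = F"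
  shows "residual_sq (column_submatrix (incidence_matrix xs Bs) cs) (vec (length cs) (\<lambda>j. h (cs ! j))) =
    (\<Sum>x\<in>set xs. ((\<Sum>m\<in>F. of_bool (x \<in> Bs ! m) * h m) - 1)\<^sup>2)"
proof -
  let ?A = "column_submatrix (incidence_matrix xs Bs) cs"
  let ?w = "vec (length cs) (\<lambda>j. h (cs ! j))"
  have lt: "cs ! j < b" if "j < length cs" for j
    using that cs F nth_mem by blast
  have dim: "dim_row ?A = v" "dim_col ?A = length cs"
    by (simp_all add: column_submatrix_def incidence_matrix_def length_points)
  have "(?A *\<^sub>v ?w) $ x = (\<Sum>m\<in>F. of_bool (xs ! x \<in> Bs ! m) * h m)" if x: "x < v" for x
  proof -
    have "(?A *\<^sub>v ?w) $ x = (\<Sum>j<length cs. ?A $$ (x, j) * h (cs ! j))"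
      using x dim by (simp add: scalar_prod_def lessThan_atLeast0)
    also have "\<dots> = (\<Sum>j<length cs. of_bool (xs ! x \<in> Bs ! (cs ! j)) * h (cs ! j))"
    proof (intro sum.cong refl)
      fix j assume "j \<in> {..<length cs}"
      then show "?A $$ (x, j) * h (cs ! j) = of_bool (xs ! x \<in> Bs ! (cs ! j)) * h (cs ! j)"
        using x lt[of j] dim(1)
        by (simp add: column_submatrix_def incidence_entry)
    qed
    also have "\<dots> = (\<Sum>m\<in>F. of_bool (xs ! x \<in> Bs ! m) * h m)"
      using sum_nth_eq[OF cs(1), of "\<lambda>m. of_bool (xs ! x \<in> Bs ! m) * h m"] cs(2) by simp
    finally show ?thesis .
  qed
  then have "residual_sq ?A ?w =
      (\<Sum>x<v. ((\<Sum>m\<in>F. of_bool (xs ! x \<in> Bs ! m) * h m) - 1)\<^sup>2)"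
    using dim by (simp add: residual_sq_def scalar_prod_def lessThan_atLeast0 power2_eq_square)
  then show ?thesis
    using sum_nth_eq[OF distinct_points, of "\<lambda>x. ((\<Sum>m\<in>F. of_bool (x \<in> Bs ! m) * h m) - 1)\<^sup>2"]
      length_points by simp
qed

text \<open>If the residual \<open>d\<close> is orthogonal to every column, any other vector changes
  it by some \<open>e\<close> in the column span, and the squared norm of \<open>d + e\<close> is
  that of \<open>d\<close> plus that of \<open>e\<close>.\<close>

lemma optimal_if_orthogonal:
  assumes F: "F \<subseteq> {..<b}" and cs: "distinct cs" "set cs = F"
    and orth: "\<And>m. m \<in> F \<Longrightarrow>
      (\<Sum>x\<in>set xs. of_bool (x \<in> Bs ! m) * ((\<Sum>n\<in>F. of_bool (x \<in> Bs ! n) * h n) - 1)) = 0"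
  defines "w \<equiv> vec (length cs) (\<lambda>j. h (cs ! j))"
  shows "optimal_decoding_vector (incidence_matrix xs Bs) cs w"
    and "approx_error (incidence_matrix xs Bs) cs =
      (\<Sum>x\<in>set xs. ((\<Sum>m\<in>F. of_bool (x \<in> Bs ! m) * h m) - 1)\<^sup>2)"
proof -
  let ?res = "residual_sq (column_submatrix (incidence_matrix xs Bs) cs)"
  define d where "d x = (\<Sum>n\<in>F. of_bool (x \<in> Bs ! n) * h n) - 1" for x
  have w: "?res w = (\<Sum>x\<in>set xs. (d x)\<^sup>2)"
    unfolding w_def d_def by (rule residual_sq_columns[OF F cs])
  have min: "?res w \<le> ?res u" if u: "u \<in> carrier_vec (length cs)" for u
  proof -
    \<comment> \<open>Reads an arbitrary competitor \<open>u\<close> as a function on block indices,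
      which is possible because \<open>cs\<close> is distinct.\<close>
    define g where "g m = u $ (inv_into {..<length cs} ((!) cs) m)" for m
    have inj: "inj_on ((!) cs) {..<length cs}"
      using cs(1) by (auto simp: inj_on_def nth_eq_iff_index_eq)
    have "u = vec (length cs) (\<lambda>j. g (cs ! j))"
      using u by (intro eq_vecI) (auto simp: g_def inv_into_f_f[OF inj])
    then have "?res u = (\<Sum>x\<in>set xs. ((\<Sum>m\<in>F. of_bool (x \<in> Bs ! m) * g m) - 1)\<^sup>2)"
      using residual_sq_columns[OF F cs, of g] by simp
    also have "\<dots> = (\<Sum>x\<in>set xs. (d x + (\<Sum>m\<in>F. of_bool (x \<in> Bs ! m) * (g m - h m)))\<^sup>2)"
      by (simp only: d_def right_diff_distrib sum_subtractf) (simp add: algebra_simps)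
    \<comment> \<open>The squared increment is dropped; the cross term kept here vanishes by
      orthogonality.\<close>
    also have "\<dots> \<ge> (\<Sum>x\<in>set xs. (d x)\<^sup>2 + 2 * (\<Sum>m\<in>F. (g m - h m) * (of_bool (x \<in> Bs ! m) * d x)))"
    proof (rule sum_mono)
      fix x
      let ?e = "\<Sum>m\<in>F. of_bool (x \<in> Bs ! m) * (g m - h m)"
      have "(\<Sum>m\<in>F. (g m - h m) * (of_bool (x \<in> Bs ! m) * d x)) = d x * ?e"
        by (simp only: sum_distrib_left mult_ac)
      then show "(d x)\<^sup>2 + 2 * (\<Sum>m\<in>F. (g m - h m) * (of_bool (x \<in> Bs ! m) * d x)) \<le> (d x + ?e)\<^sup>2"
        by (simp add: power2_sum)
    qed
    also have "(\<Sum>x\<in>set xs. (d x)\<^sup>2 + 2 * (\<Sum>m\<in>F. (g m - h m) * (of_bool (x \<in> Bs ! m) * d x))) =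
        ?res w + 2 * (\<Sum>x\<in>set xs. \<Sum>m\<in>F. (g m - h m) * (of_bool (x \<in> Bs ! m) * d x))"
      by (simp only: w sum.distrib sum_distrib_left)
    also have "(\<Sum>x\<in>set xs. \<Sum>m\<in>F. (g m - h m) * (of_bool (x \<in> Bs ! m) * d x)) =
        (\<Sum>m\<in>F. (g m - h m) * (\<Sum>x\<in>set xs. of_bool (x \<in> Bs ! m) * d x))"
      by (subst sum.swap) (simp only: sum_distrib_left)
    also have "\<dots> = 0"
      using orth unfolding d_def by (intro sum.neutral) simp
    finally show ?thesis by simp
  qed
  have wc: "w \<in> carrier_vec (length cs)" by (simp add: w_def)
  show "optimal_decoding_vector (incidence_matrix xs Bs) cs w"
    unfolding optimal_decoding_vector_def is_arg_min_linorder using min wc by blast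
  show "approx_error (incidence_matrix xs Bs) cs =
      (\<Sum>x\<in>set xs. ((\<Sum>m\<in>F. of_bool (x \<in> Bs ! m) * h m) - 1)\<^sup>2)"
    unfolding approx_error_def d_def[symmetric] w[symmetric]
    by (rule Least_equality) (use min wc in auto)
qed

subsection \<open>The two straggler regimes\<close>

lemma covered_class_sum:
  assumes "F \<subseteq> {..<b}" and "i \<in> {1..r}" and "T i \<subseteq> F" and "x \<in> set xs"
  shows "(\<Sum>m\<in>F. of_bool (x \<in> Bs ! m) * of_bool (class_index m = i)) = (1::real)"
proof -
  have "(\<Sum>m\<in>F. of_bool (x \<in> Bs ! m) * of_bool (class_index m = i)) =
      (\<Sum>m\<in>T i. of_bool (x \<in> Bs ! m) * of_bool (class_index m = i) :: real)"
    using assms class_index finite_subset[OF assms(1)]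
    by (intro sum.mono_neutral_right) auto
  also have "\<dots> = (\<Sum>m\<in>T i. of_bool (x \<in> Bs ! m))"
    using class_index_eq[OF assms(2)] by (intro sum.cong) auto
  finally show ?thesis using sum_class_mem assms by simp
qed

text \<open>Expands by the Gram matrix: in the class of \<open>m\<close> only \<open>m\<close>
  itself survives, and every column of another class contributes \<open>\<mu>\<close>. The result
  depends on \<open>m\<close> only through \<open>i\<close>, which reduces the normal equations to
  one per class.\<close>

lemma column_inner_residual:
  assumes affine: "int b = int v + int r - 1" and F: "F \<subseteq> {..<b}"
    and i: "i \<in> {1..r}" and m: "m \<in> F \<inter> T i"
  defines "\<mu> \<equiv> (real k)\<^sup>2 / real v"
  shows "(\<Sum>x\<in>set xs. of_bool (x \<in> Bs ! m) * ((\<Sum>n\<in>F. of_bool (x \<in> Bs ! n) * c (class_index n)) - 1)) =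
    real k * c i + (\<Sum>p\<in>{1..r} - {i}. \<mu> * real (card (F \<inter> T p)) * c p) - real k"
proof -
  have mb: "m < b" using F m by blast
  have inner: "(\<Sum>x\<in>set xs. of_bool (x \<in> Bs ! m) * of_bool (x \<in> Bs ! n)) =
      real (card (Bs ! m \<inter> Bs ! n))" for n
  proof -
    have "Bs ! m \<inter> Bs ! n = set xs \<inter> {x. x \<in> Bs ! m \<and> x \<in> Bs ! n}"
      using block_subset[OF mb] by blast
    then show ?thesis by (simp add: flip: of_bool_conj)
  qed
  have block: "(\<Sum>x\<in>set xs. of_bool (x \<in> Bs ! m)) = real k"
    using card_block[OF mb] block_subset[OF mb] by (simp add: Int_absorb1)
  have "(\<Sum>x\<in>set xs. of_bool (x \<in> Bs ! m) * ((\<Sum>n\<in>F. of_bool (x \<in> Bs ! n) * c (class_index n)) - 1)) =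
      (\<Sum>x\<in>set xs. \<Sum>n\<in>F. of_bool (x \<in> Bs ! m) * of_bool (x \<in> Bs ! n) * c (class_index n)) - real k"
    by (simp only: right_diff_distrib sum_subtractf sum_distrib_left mult.assoc mult_1_right block)
  also have "(\<Sum>x\<in>set xs. \<Sum>n\<in>F. of_bool (x \<in> Bs ! m) * of_bool (x \<in> Bs ! n) * c (class_index n)) =
      (\<Sum>n\<in>F. real (card (Bs ! m \<inter> Bs ! n)) * c (class_index n))"
    by (subst sum.swap) (simp only: sum_distrib_right[symmetric] inner)
  also have "\<dots> = (\<Sum>p=1..r. \<Sum>n\<in>F \<inter> T p. real (card (Bs ! m \<inter> Bs ! n)) * c (class_index n))"
    by (rule sum_by_classes[OF F])
  also have "\<dots> = (\<Sum>n\<in>F \<inter> T i. real (card (Bs ! m \<inter> Bs ! n)) * c (class_index n)) +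
      (\<Sum>p\<in>{1..r} - {i}. \<Sum>n\<in>F \<inter> T p. real (card (Bs ! m \<inter> Bs ! n)) * c (class_index n))"
    using i by (intro sum.remove) auto
  also have "(\<Sum>n\<in>F \<inter> T i. real (card (Bs ! m \<inter> Bs ! n)) * c (class_index n)) =
      (\<Sum>n\<in>F \<inter> T i. if n = m then real k * c i else 0)"
    using m class_inter[OF i, of m] class_index_eq[OF i] by (intro sum.cong) auto
  also have "\<dots> = real k * c i"
    using m finite_class[OF i] by simp
  also have "(\<Sum>p\<in>{1..r} - {i}. \<Sum>n\<in>F \<inter> T p. real (card (Bs ! m \<inter> Bs ! n)) * c (class_index n)) =
      (\<Sum>p\<in>{1..r} - {i}. \<mu> * real (card (F \<inter> T p)) * c p)"
  proof (intro sum.cong refl)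
    fix p assume p: "p \<in> {1..r} - {i}"
    have "(\<Sum>n\<in>F \<inter> T p. real (card (Bs ! m \<inter> Bs ! n)) * c (class_index n)) =
        (\<Sum>n\<in>F \<inter> T p. \<mu> * c p)"
    proof (intro sum.cong refl)
      fix n assume n: "n \<in> F \<inter> T p"
      then have "n < b" "n \<notin> T i" "class_index n = p"
        using F p i classes_disjoint[of i p] class_index_eq[of p n] by auto
      then show "real (card (Bs ! m \<inter> Bs ! n)) * c (class_index n) = \<mu> * c p"
        using affine_inter[OF affine i(1)] m by (simp add: \<mu>_def)
    qed
    then show "(\<Sum>n\<in>F \<inter> T p. real (card (Bs ! m \<inter> Bs ! n)) * c (class_index n)) =
        \<mu> * real (card (F \<inter> T p)) * c p"
      by simp
  qed
  finally show ?thesis .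
qed

text \<open>By orthogonality of the residual \<open>d\<close> to the columns, \<open>d \<bullet> d = - (d \<bullet> 1)\<close>.\<close>

lemma orthogonal_residual_norm:
  assumes F: "F \<subseteq> {..<b}"
    and orth: "\<And>m. m \<in> F \<Longrightarrow>
      (\<Sum>x\<in>set xs. of_bool (x \<in> Bs ! m) * ((\<Sum>n\<in>F. of_bool (x \<in> Bs ! n) * h n) - 1)) = 0"
  shows "(\<Sum>x\<in>set xs. ((\<Sum>m\<in>F. of_bool (x \<in> Bs ! m) * h m) - 1)\<^sup>2) =
    real v - real k * (\<Sum>m\<in>F. h m)"
proof -
  define d where "d x = (\<Sum>m\<in>F. of_bool (x \<in> Bs ! m) * h m) - 1" for x
  have "(\<Sum>x\<in>set xs. (d x)\<^sup>2) =
      (\<Sum>x\<in>set xs. (\<Sum>m\<in>F. h m * (of_bool (x \<in> Bs ! m) * d x)) - d x)"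
  proof (intro sum.cong refl)
    fix x
    have "(\<Sum>m\<in>F. h m * (of_bool (x \<in> Bs ! m) * d x)) = (d x + 1) * d x"
      by (simp add: d_def sum_distrib_left sum_distrib_right mult_ac)
    then show "(d x)\<^sup>2 = (\<Sum>m\<in>F. h m * (of_bool (x \<in> Bs ! m) * d x)) - d x"
      by (simp add: power2_eq_square algebra_simps)
  qed
  also have "\<dots> = (\<Sum>m\<in>F. h m * (\<Sum>x\<in>set xs. of_bool (x \<in> Bs ! m) * d x)) - (\<Sum>x\<in>set xs. d x)"
    by (simp only: sum_subtractf sum_distrib_left) (subst sum.swap, rule refl)
  also have "(\<Sum>m\<in>F. h m * (\<Sum>x\<in>set xs. of_bool (x \<in> Bs ! m) * d x)) = 0"
    using orth unfolding d_def by (intro sum.neutral) simp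
  also have "(\<Sum>x\<in>set xs. d x) = (\<Sum>m\<in>F. (\<Sum>x\<in>set xs. of_bool (x \<in> Bs ! m)) * h m) - real v"
    unfolding d_def sum_subtractf sum_distrib_right using card_points
    by (subst sum.swap) simp
  also have "(\<Sum>m\<in>F. (\<Sum>x\<in>set xs. of_bool (x \<in> Bs ! m)) * h m) = (\<Sum>m\<in>F. real k * h m)"
    using F card_block block_subset by (intro sum.cong refl) (auto simp: Int_absorb1 subset_iff)
  finally show ?thesis by (simp add: d_def sum_distrib_left)
qed

end

text \<open>Adding and subtracting \<open>\<mu> * n i * c i\<close> splits the left side into
  \<open>(L - \<mu> * n i) * c i\<close>, equal to \<open>L / (1 + Q)\<close> for every
  \<open>i\<close>, and the full sum, equal to \<open>Q * (L / (1 + Q))\<close>.\<close>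

lemma class_weights_solve:
  fixes L \<mu> :: real and n c :: "nat \<Rightarrow> real"
  assumes "finite I" and pos: "\<And>p. p \<in> I \<Longrightarrow> 0 < L - \<mu> * n p"
    and nonneg: "\<And>p. p \<in> I \<Longrightarrow> 0 \<le> \<mu> * n p"
    and c: "\<And>i. c i = (L / (L - \<mu> * n i)) / (1 + (\<Sum>p\<in>I. \<mu> * n p / (L - \<mu> * n p)))"
    and i: "i \<in> I"
  shows "L * c i + (\<Sum>p\<in>I - {i}. \<mu> * n p * c p) = L"
proof -
  define Q where "Q = (\<Sum>p\<in>I. \<mu> * n p / (L - \<mu> * n p))"
  have "0 \<le> Q"
    unfolding Q_def using pos nonneg by (intro sum_nonneg divide_nonneg_pos) auto
  then have Q: "1 + Q \<noteq> 0" by simp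
  have "(\<Sum>p\<in>I. \<mu> * n p * c p) = (\<Sum>p\<in>I. \<mu> * n p / (L - \<mu> * n p) * (L / (1 + Q)))"
    unfolding c Q_def[symmetric] by (intro sum.cong) auto
  also have "\<dots> = Q * (L / (1 + Q))"
    by (simp only: Q_def sum_distrib_right)
  finally have "(\<Sum>p\<in>I. \<mu> * n p * c p) = Q * (L / (1 + Q))" .
  moreover have "(\<Sum>p\<in>I. \<mu> * n p * c p) = \<mu> * n i * c i + (\<Sum>p\<in>I - {i}. \<mu> * n p * c p)"
    using \<open>finite I\<close> i by (rule sum.remove)
  moreover have "(L - \<mu> * n i) * c i = L / (1 + Q)"
    unfolding c Q_def[symmetric] using pos[OF i] by simp
  moreover have "L / (1 + Q) + Q * (L / (1 + Q)) = L"
    using Q by (simp add: add_divide_distrib[symmetric] distrib_left[symmetric]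
        nonzero_divide_eq_eq algebra_simps)
  ultimately show ?thesis by (simp add: algebra_simps)
qed

text \<open>The first sum in the error has coefficient 1, not 2 as in the informal statement: with
  \<open>n i\<close> non-stragglers in class \<open>i\<close>, the squared norm has linear part
  \<open>- 2 * L * n i * c i\<close> and diagonal part \<open>L * n i * (c i)^2\<close>, together
  \<open>L * n i * c i * (c i - 2)\<close>.\<close>

theorem theorem3:
  fixes xs :: "'a list" and Bs :: "'a set list"
    and v b k r l N K L R S :: nat
    and E :: "real mat"
    and T :: "nat \<Rightarrow> nat set"
    and F :: "nat set" and cs :: "nat list"
    and \<mu> :: real and St Sh c :: "nat \<Rightarrow> real"
  assumes "gradient_code N K L R E"
    and "affine_resolvable_bibd v b k r l xs Bs"
    and "E = incidence_matrix xs Bs"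
    and "resolution xs Bs r T"
    and "S \<le> N" and "F \<subseteq> {..<N}" and "card F = N - S"
    and "ordered_by_classes R T F cs"
    and "\<mu> = (real L)\<^sup>2 / real K"
    and "\<And>i. St i = real K / real L - real (card (F \<inter> T i))"
    and "\<And>i. Sh i = (\<Sum>p=1..i. real K / real L - St p)"
    and "\<And>i. c i = (real L / (real L - \<mu> * (real K / real L - St i))) /
           (1 + (\<Sum>p=1..R. \<mu> * (real K / real L - St p) /
                            (real L - \<mu> * (real K / real L - St p))))"
  shows "N = b \<and> K = v \<and> L = k \<and> R = r \<and>
    (\<forall>i\<in>{1..R}. St i = 0 \<longrightarrow>
       optimal_decoding_vector E cs
         (vec (N - S) (\<lambda>j. if Sh (i - 1) + 1 \<le> real (Suc j) \<and> real (Suc j) \<le> Sh i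
                           then 1 else 0)) \<and>
       approx_error E cs = 0) \<and>
    ((\<forall>i\<in>{1..R}. St i > 0) \<longrightarrow>
       (\<exists>w\<in>carrier_vec (N - S).
          (\<forall>i\<in>{1..R}. \<forall>j<N - S.
             Sh (i - 1) + 1 \<le> real (Suc j) \<and> real (Suc j) \<le> Sh i \<longrightarrow> w $ j = c i) \<and>
          optimal_decoding_vector E cs w) \<and>
       approx_error E cs =
         real K + (\<Sum>i=1..R. real L * (real K / real L - St i) * c i * (c i - 2)) +
         (\<Sum>i=1..R. \<Sum>j\<in>{1..R} - {i}.
            \<mu> * (real K / real L - St i) * (real K / real L - St j) * c i * c j))"
proof -
  interpret resolved_bibd v b k r l xs Bs T
    using assms(2,4) by unfold_locales (auto simp: affine_resolvable_bibd_def)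
  have affine: "int b = int v + int r - 1"
    using assms(2) by (simp add: affine_resolvable_bibd_def)
  have par: "N = b" "K = v" "L = k" "R = r"
    using gradient_code_parameters assms(1,3) by auto
  have v: "0 < v" and b: "0 < b"
    using assms(1) par by (auto simp: gradient_code_def)
  have k: "0 < k" using block_size_pos[OF b] .
  have F: "F \<subseteq> {..<b}" using assms(6) par by simp
  have ord: "ordered_by_classes r T F cs" using assms(8) par by simp
  then have cs: "distinct cs" "set cs = F" by (auto simp: ordered_by_classes_def)
  then have len: "length cs = N - S"
    using distinct_card assms(7) by metis
  define n where "n p = real (card (F \<inter> T p))" for p
  have n: "real v / real k - St p = n p" for p
    using assms(10)[of p] par by (simp add: n_def)
  have Sh: "Sh i = real (\<Sum>p=1..i. card (F \<inter> T p))" for i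
    using assms(11)[of i] par n by (simp add: n_def)
  have pos: "Sh (i - 1) + 1 \<le> real (Suc j) \<and> real (Suc j) \<le> Sh i \<longleftrightarrow> class_index (cs ! j) = i"
    if "i \<in> {1..r}" "j < N - S" for i j
    using column_position[OF F ord that(1) _ Sh] that(2) len by simp
  \<comment> \<open>The quotient \<open>K / L\<close> is the size of a class, so
    \<open>St i = 0\<close> forces all of \<open>T i\<close> into \<open>F\<close>.\<close>
  have quot: "real v / real k = real (card (T i))" if "i \<in> {1..r}" for i
    using card_class_mult[OF that] k by (simp add: field_simps flip: of_nat_mult)
  have part1: "optimal_decoding_vector E cs
         (vec (N - S) (\<lambda>j. if Sh (i - 1) + 1 \<le> real (Suc j) \<and> real (Suc j) \<le> Sh i
                           then 1 else 0)) \<and> approx_error E cs = 0"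
    if i: "i \<in> {1..r}" and St: "St i = 0" for i
  proof -
    have "card (F \<inter> T i) = card (T i)"
      using n[of i] quot[OF i] St by (simp add: n_def)
    then have sub: "T i \<subseteq> F"
      using card_subset_eq[of "T i" "F \<inter> T i"] finite_class[OF i] by auto
    have w: "vec (N - S) (\<lambda>j. if Sh (i - 1) + 1 \<le> real (Suc j) \<and> real (Suc j) \<le> Sh i
        then 1 else 0) = vec (length cs) (\<lambda>j. of_bool (class_index (cs ! j) = i) :: real)"
      using pos[OF i] len by (intro eq_vecI) auto
    have one: "(\<Sum>m\<in>F. of_bool (x \<in> Bs ! m) * of_bool (class_index m = i)) = (1::real)"
      if "x \<in> set xs" for x
      using covered_class_sum[OF F i sub that] .
    \<comment> \<open>Orthogonality is immediate since the residual itself vanishes at every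
      point.\<close>
    have orth: "(\<Sum>x\<in>set xs. of_bool (x \<in> Bs ! m) *
        ((\<Sum>n\<in>F. of_bool (x \<in> Bs ! n) * of_bool (class_index n = i)) - 1)) = (0::real)" for m
      by (rule sum.neutral) (use one in simp)
    note opt = optimal_if_orthogonal[OF F cs orth]
    have "approx_error E cs = 0"
      unfolding assms(3) opt(2) by (rule sum.neutral) (use one in simp)
    then show ?thesis
      using opt(1) assms(3) w by simp
  qed
  have part2: "(\<exists>w\<in>carrier_vec (N - S).
          (\<forall>i\<in>{1..r}. \<forall>j<N - S.
             Sh (i - 1) + 1 \<le> real (Suc j) \<and> real (Suc j) \<le> Sh i \<longrightarrow> w $ j = c i) \<and>
          optimal_decoding_vector E cs w) \<and>
       approx_error E cs =
         real v + (\<Sum>i=1..r. real k * n i * c i * (c i - 2)) +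
         (\<Sum>i=1..r. \<Sum>j\<in>{1..r} - {i}. \<mu> * n i * n j * c i * c j)"
    if St: "\<forall>i\<in>{1..r}. St i > 0"
  proof -
    have \<mu>: "\<mu> = (real k)\<^sup>2 / real v" using assms(9) par by simp
    \<comment> \<open>A straggler in each class gives \<open>n p < v / k\<close>, and
      \<open>\<mu> * (v / k) = k\<close>; hence all denominators in \<open>c\<close> are
      positive.\<close>
    have gap: "0 < real k - \<mu> * n p" if "p \<in> {1..r}" for p
    proof -
      have "\<mu> * n p < \<mu> * (real v / real k)"
        using bspec[OF St that] n[of p] v k \<mu> by (intro mult_strict_left_mono) auto
      also have "\<dots> = real k"
        using v k \<mu> by (simp add: power2_eq_square)
      finally show ?thesis by simp
    qed
    have solve: "real k * c i + (\<Sum>p\<in>{1..r} - {i}. \<mu> * n p * c p) = real k" if "i \<in> {1..r}" for i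
    proof (rule class_weights_solve[OF _ gap _ _ that])
      show "0 \<le> \<mu> * n p" for p by (simp add: \<mu> n_def)
      show "c i = (real k / (real k - \<mu> * n i)) /
          (1 + (\<Sum>p=1..r. \<mu> * n p / (real k - \<mu> * n p)))" for i
        using assms(12)[of i] by (simp only: par n)
    qed auto
    have orth: "(\<Sum>x\<in>set xs. of_bool (x \<in> Bs ! m) *
        ((\<Sum>n\<in>F. of_bool (x \<in> Bs ! n) * c (class_index n)) - 1)) = 0" if "m \<in> F" for m
    proof -
      have m: "class_index m \<in> {1..r}" "m \<in> F \<inter> T (class_index m)"
        using class_index[of m] F that by auto
      show ?thesis
        using column_inner_residual[OF affine F m, of c] solve[OF m(1)] by (simp add: \<mu> n_def)
    qed
    note opt = optimal_if_orthogonal[where h = "\<lambda>m. c (class_index m)", OF F cs orth]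
    have "(\<Sum>m\<in>F. c (class_index m)) = (\<Sum>p=1..r. \<Sum>m\<in>F \<inter> T p. c (class_index m))"
      by (rule sum_by_classes[OF F])
    also have "\<dots> = (\<Sum>p=1..r. \<Sum>m\<in>F \<inter> T p. c p)"
      using class_index_eq by (intro sum.cong refl) auto
    finally have total: "(\<Sum>m\<in>F. c (class_index m)) = (\<Sum>p=1..r. n p * c p)"
      by (simp add: n_def)
    \<comment> \<open>Orthogonality gives the short form
      \<open>v - k * (\<Sum>m\<in>F. c (class_index m))\<close> of the error. The claimed formula
      collapses to it because \<open>solve\<close> turns each inner sum over \<open>j\<close> into
      \<open>n i * c i * (k - k * c i)\<close>.\<close>
    have "(\<Sum>i=1..r. real k * n i * c i * (c i - 2)) +
        (\<Sum>i=1..r. \<Sum>j\<in>{1..r} - {i}. \<mu> * n i * n j * c i * c j) =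
        (\<Sum>i=1..r. - real k * (n i * c i))"
      unfolding sum.distrib[symmetric]
    proof (intro sum.cong refl)
      fix i assume i: "i \<in> {1..r}"
      have "(\<Sum>j\<in>{1..r} - {i}. \<mu> * n i * n j * c i * c j) =
          n i * c i * (\<Sum>j\<in>{1..r} - {i}. \<mu> * n j * c j)"
        by (simp add: sum_distrib_left mult_ac)
      also have "(\<Sum>j\<in>{1..r} - {i}. \<mu> * n j * c j) = real k - real k * c i"
        using solve[OF i] by linarith
      finally show "real k * n i * c i * (c i - 2) +
          (\<Sum>j\<in>{1..r} - {i}. \<mu> * n i * n j * c i * c j) = - real k * (n i * c i)"
        by (simp add: algebra_simps)
    qed
    also have "\<dots> = - real k * (\<Sum>m\<in>F. c (class_index m))"
      by (simp only: total sum_distrib_left)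
    finally have err: "approx_error E cs =
         real v + (\<Sum>i=1..r. real k * n i * c i * (c i - 2)) +
         (\<Sum>i=1..r. \<Sum>j\<in>{1..r} - {i}. \<mu> * n i * n j * c i * c j)"
      using opt(2) orthogonal_residual_norm[where h = "\<lambda>m. c (class_index m)", OF F orth] assms(3)
      by simp
    show ?thesis
    \<comment> \<open>Every position lies in exactly one of the intervals, so the interval
      conditions determine this witness.\<close>
    proof (intro conjI bexI[of _ "vec (length cs) (\<lambda>j. c (class_index (cs ! j)))"] ballI allI impI)
      fix i j assume "i \<in> {1..r}" "j < N - S"
        "Sh (i - 1) + 1 \<le> real (Suc j) \<and> real (Suc j) \<le> Sh i"
      then show "vec (length cs) (\<lambda>j. c (class_index (cs ! j))) $ j = c i"
        using pos len by auto
    qed (use opt(1) assms(3) err len in auto)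
  qed
  show ?thesis
    using part1 part2 by (simp only: par n simp_thms) blast
qed

end
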